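(* (Nonholonomic oscillator.) Let $m>0$ and let $U$ be a smooth function of $\mathbf q=(q_1,q_2)\in\mathbb{R}^2$. Consider the mass point in $\mathbb{R}^3$ with Lagrangian $L=\frac12m(\dot q_1^2+\dot q_2^2+\dot q_3^2)-U(\mathbf q)$ and nonholonomic constraint $\dot q_3-q_2\dot q_1=0$, and its reduced system in the variables $(\mathbf q,\mathbf P)\in\mathbb{R}^4$ (see context). Then: (1) The reduced system has the invariant measure $\mathcal N(\mathbf q)\,d\mathbf q\,d\mathbf P$ with $\mathcal N(\mathbf q)=(1+q_2^2)^{-1/2}$. (2) In the variables $(\mathbf q,\mathbf p)$, $\mathbf p=\mathcal N(\mathbf q)\mathbf P$, and after the time rescaling $d\tau=\mathcal N\,dt$, the equations of motion are Hamiltonian with the canonical Poisson bracket ($\{q_i,p_j\}=\delta_{ij}$, $\{q_i,q_j\}=\{p_i,p_j\}=0$) and the Hamiltonian $$\overline H=\frac{p_1^2}{2m}+\frac{(1+q_2^2)p_2^2}{2m}+U(\mathbf q).$$ (3) The change of variables $$x=q_1,\quad p_x=p_1,\quad y=\ln\bigl((1+q_2^2)^{1/2}+q_2\bigr),\quad p_y=(1+q_2^2)^{1/2}p_2$$ is canonical and transforms $\overline H$ into $$H^{(p)}=\frac{p_x^2+p_y^2}{2m}+V(x,y),\qquad V(x,y)=U(x,q_2(y)),$$ i.e. the problem reduces to the motion of a mass point on the plane in the potential field $V$.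
   Context: For the constraint $\dot q_3=a_1(\mathbf q)\dot q_1+a_2(\mathbf q)\dot q_2$ let $L^*$ be $L$ with $\dot q_3$ eliminated by the constraint, $S=\left(\frac{\partial L}{\partial\dot q_3}\right)^{*}\left(\frac{\partial a_1}{\partial q_2}-\frac{\partial a_2}{\partial q_1}\right)$ (with $(\cdot)^*$ meaning that $\dot q_3$ is eliminated by the constraint after differentiation), $P_i=\partial L^*/\partial\dot q_i$ ($i=1,2$), $H=P_1\dot q_1+P_2\dot q_2-L^*$ as a function of $(\mathbf q,\mathbf P)$. The reduced system is $$\dot q_i=\frac{\partial H}{\partial P_i},\quad \dot P_1=-\frac{\partial H}{\partial q_1}+\frac{\partial H}{\partial P_2}S,\quad \dot P_2=-\frac{\partial H}{\partial q_2}-\frac{\partial H}{\partial P_1}S .$$ A measure $\mathcal N\,d\mathbf q\,d\mathbf P$ is invariant if $\operatorname{div}(\mathcal N\mathbf v)=0$ for the vector field $\mathbf v$ of this system. Here $a_1=q_2$, $a_2=0$, and $q_2(y)$ denotes the inverse of the function $y(q_2)$ in (3). *)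

theory Defs
  imports "HOL-Analysis.Analysis"
begin

section \<open>Calculus\<close>

text \<open>A map is \<open>C\<^sup>0\<close> if it is continuous, and \<open>C\<^sup>n\<^sup>+\<^sup>1\<close> if it is differentiable and all its
  directional derivatives are \<open>C\<^sup>n\<close>.\<close>

primrec C_times :: "nat \<Rightarrow> ('a::euclidean_space \<Rightarrow> 'b::euclidean_space) \<Rightarrow> bool" where
  "C_times 0 f \<longleftrightarrow> continuous_on UNIV f"
| "C_times (Suc n) f \<longleftrightarrow>
     (\<forall>x. f differentiable (at x)) \<and> (\<forall>h. C_times n (\<lambda>x. frechet_derivative f (at x) h))"

definition smooth :: "('a::euclidean_space \<Rightarrow> 'b::euclidean_space) \<Rightarrow> bool" where
  "smooth f \<longleftrightarrow> (\<forall>n. C_times n f)"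

definition diffeo :: "('a::euclidean_space \<Rightarrow> 'b::euclidean_space) \<Rightarrow> bool" where
  "diffeo f \<longleftrightarrow> bij f \<and> smooth f \<and> smooth (inv f)"

definition dir_deriv :: "'a::euclidean_space \<Rightarrow> ('a \<Rightarrow> real) \<Rightarrow> 'a \<Rightarrow> real" where
  "dir_deriv b f x = deriv (\<lambda>t. f (x + t *\<^sub>R b)) 0"

abbreviation partial :: "'n::finite \<Rightarrow> (real^'n \<Rightarrow> real) \<Rightarrow> real^'n \<Rightarrow> real" where
  "partial i \<equiv> dir_deriv (axis i 1)"

definition divergence :: "('a::euclidean_space \<Rightarrow> 'a) \<Rightarrow> 'a \<Rightarrow> real" where
  "divergence v x = (\<Sum>b\<in>Basis. dir_deriv b (\<lambda>y. v y \<bullet> b) x)"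

text \<open>The differentiability clause excludes that the divergence vanishes only by way of an
  unspecified value of \<^const>\<open>deriv\<close>.\<close>

definition invariant_measure :: "('a::euclidean_space \<Rightarrow> real) \<Rightarrow> ('a \<Rightarrow> 'a) \<Rightarrow> bool" where
  "invariant_measure \<rho> v \<longleftrightarrow>
     (\<forall>x. (\<lambda>y. \<rho> y *\<^sub>R v y) differentiable (at x)) \<and>
     (\<forall>x. divergence (\<lambda>y. \<rho> y *\<^sub>R v y) x = 0)"


section \<open>Equations of motion and changes of variables\<close>

definition solves :: "('a::euclidean_space \<Rightarrow> 'a) \<Rightarrow> (real \<Rightarrow> 'a) \<Rightarrow> real set \<Rightarrow> bool" where
  "solves v z I \<longleftrightarrow> (\<forall>t\<in>I. (z has_vector_derivative v (z t)) (at t))"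

text \<open>In the variables \<open>\<Phi> z\<close> and after the time rescaling \<open>d\<tau> = \<nu>(z) dt\<close>, the equations of motion
  \<open>dz/dt = v(z)\<close> become \<open>d\<zeta>/d\<tau> = w(\<zeta>)\<close>. Here \<open>\<zeta>\<close> is the curve \<open>\<Phi> z(t)\<close> parametrised by \<open>\<tau>\<close>.\<close>

definition transforms_into ::
  "('a::euclidean_space \<Rightarrow> 'a) \<Rightarrow> ('a \<Rightarrow> real) \<Rightarrow> ('a \<Rightarrow> 'b::euclidean_space) \<Rightarrow> ('b \<Rightarrow> 'b) \<Rightarrow> bool"
  where
  "transforms_into v \<nu> \<Phi> w \<longleftrightarrow>
     (\<forall>I z \<tau> \<zeta>. open I \<longrightarrow> is_interval I \<longrightarrow>
        (\<forall>t\<in>I. (\<tau> has_real_derivative \<nu> (z t)) (at t)) \<longrightarrow>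
        (\<forall>t\<in>I. \<zeta> (\<tau> t) = \<Phi> (z t)) \<longrightarrow>
        (solves v z I \<longleftrightarrow> solves w \<zeta> (\<tau> ` I)))"


section \<open>Hamiltonian mechanics on the phase space with coordinates \<open>(q, p)\<close>\<close>

type_synonym phase = "(real^2) \<times> (real^2)"

abbreviation partial_q :: "2 \<Rightarrow> (phase \<Rightarrow> real) \<Rightarrow> phase \<Rightarrow> real" where
  "partial_q i \<equiv> dir_deriv (axis i 1, 0)"

abbreviation partial_p :: "2 \<Rightarrow> (phase \<Rightarrow> real) \<Rightarrow> phase \<Rightarrow> real" where
  "partial_p i \<equiv> dir_deriv (0, axis i 1)"

definition poisson :: "(phase \<Rightarrow> real) \<Rightarrow> (phase \<Rightarrow> real) \<Rightarrow> phase \<Rightarrow> real" where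
  "poisson F G z =
     (\<Sum>i\<in>UNIV. partial_q i F z * partial_p i G z - partial_p i F z * partial_q i G z)"

definition hamiltonian_field :: "(phase \<Rightarrow> real) \<Rightarrow> phase \<Rightarrow> phase" where
  "hamiltonian_field H z =
     (\<chi> i. poisson (\<lambda>(q, p). q $ i) H z, \<chi> i. poisson (\<lambda>(q, p). p $ i) H z)"

definition canonical :: "(phase \<Rightarrow> phase) \<Rightarrow> bool" where
  "canonical \<Psi> \<longleftrightarrow> diffeo \<Psi> \<and>
     (\<forall>F G z. smooth F \<longrightarrow> smooth G \<longrightarrow> poisson (F \<circ> \<Psi>) (G \<circ> \<Psi>) z = poisson F G (\<Psi> z))"

lemma dir_deriv_coords:
  "dir_deriv (a, b) (\<lambda>(q, p). q $ i) z = (a::real^2) $ i"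
  "dir_deriv (a, b) (\<lambda>(q, p). p $ i) z = (b::real^2) $ i"
  unfolding dir_deriv_def by (auto simp: case_prod_beta intro!: DERIV_imp_deriv derivative_eq_intros)

lemma poisson_canonical_relations:
  "poisson (\<lambda>(q, p). q $ i) (\<lambda>(q, p). p $ j) z = (if i = j then 1 else 0)"
  "poisson (\<lambda>(q, p). q $ i) (\<lambda>(q, p). q $ j) z = 0"
  "poisson (\<lambda>(q, p). p $ i) (\<lambda>(q, p). p $ j) z = 0"
  using exhaust_2[of i] exhaust_2[of j]
  by (auto simp: poisson_def dir_deriv_coords sum_2 axis_def)

text \<open>Equations of motion of a point of mass \<open>m\<close> in the plane in the potential \<open>V\<close>, in terms of
  position and momentum.\<close>

definition mass_point_field :: "real \<Rightarrow> (real^2 \<Rightarrow> real) \<Rightarrow> phase \<Rightarrow> phase" where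
  "mass_point_field m V = (\<lambda>(r, p). ((1 / m) *\<^sub>R p, - (\<chi> i. partial i V r)))"


section \<open>The reduced system of a nonholonomic system\<close>

text \<open>The Lagrangian \<open>L\<close> takes \<open>q = (q\<^sub>1, q\<^sub>2)\<close> and the three velocities; neither \<open>L\<close> nor the
  coefficients \<open>a1\<close>, \<open>a2\<close> of the constraint depend on the third coordinate.\<close>

context
  fixes L :: "real^2 \<Rightarrow> real^3 \<Rightarrow> real"
    and a1 a2 :: "real^2 \<Rightarrow> real"
begin

definition constrained_velocity :: "real^2 \<Rightarrow> real^2 \<Rightarrow> real^3" where
  "constrained_velocity q u = vector [u $ 1, u $ 2, a1 q * u $ 1 + a2 q * u $ 2]"

definition L_star :: "real^2 \<Rightarrow> real^2 \<Rightarrow> real" where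
  "L_star q u = L q (constrained_velocity q u)"

definition S_term :: "real^2 \<Rightarrow> real^2 \<Rightarrow> real" where
  "S_term q u =
     partial 3 (L q) (constrained_velocity q u) * (partial 2 a1 q - partial 1 a2 q)"

definition momentum :: "real^2 \<Rightarrow> real^2 \<Rightarrow> real^2" where
  "momentum q u = (\<chi> i. partial i (L_star q) u)"

text \<open>The velocities as functions of \<open>(q, P)\<close>; meaningful if \<open>momentum q\<close> is bijective.\<close>

definition velocity :: "real^2 \<Rightarrow> real^2 \<Rightarrow> real^2" where
  "velocity q P = inv (momentum q) P"

definition reduced_hamiltonian :: "phase \<Rightarrow> real" where
  "reduced_hamiltonian = (\<lambda>(q, P).
     let u = velocity q P in P $ 1 * u $ 1 + P $ 2 * u $ 2 - L_star q u)"

definition reduced_field :: "phase \<Rightarrow> phase" where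
  "reduced_field = (\<lambda>(q, P).
     let H = reduced_hamiltonian; S = S_term q (velocity q P) in
       (vector [partial_p 1 H (q, P),
                partial_p 2 H (q, P)],
        vector [- partial_q 1 H (q, P) + partial_p 2 H (q, P) * S,
                - partial_q 2 H (q, P) - partial_p 1 H (q, P) * S]))"

end


section \<open>The nonholonomic oscillator\<close>

definition osc_lagrangian :: "real \<Rightarrow> (real^2 \<Rightarrow> real) \<Rightarrow> real^2 \<Rightarrow> real^3 \<Rightarrow> real" where
  "osc_lagrangian m U q u = 1/2 * m * ((u $ 1)\<^sup>2 + (u $ 2)\<^sup>2 + (u $ 3)\<^sup>2) - U q"

definition osc_field :: "real \<Rightarrow> (real^2 \<Rightarrow> real) \<Rightarrow> phase \<Rightarrow> phase" where
  "osc_field m U = reduced_field (osc_lagrangian m U) (\<lambda>q. q $ 2) (\<lambda>q. 0)"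

definition osc_density :: "real^2 \<Rightarrow> real" where
  "osc_density q = (1 + (q $ 2)\<^sup>2) powr (-1/2)"

definition osc_rescaled_momenta :: "phase \<Rightarrow> phase" where
  "osc_rescaled_momenta = (\<lambda>(q, P). (q, osc_density q *\<^sub>R P))"

definition osc_hamiltonian :: "real \<Rightarrow> (real^2 \<Rightarrow> real) \<Rightarrow> phase \<Rightarrow> real" where
  "osc_hamiltonian m U =
     (\<lambda>(q, p). (p $ 1)\<^sup>2 / (2 * m) + (1 + (q $ 2)\<^sup>2) * (p $ 2)\<^sup>2 / (2 * m) + U q)"

definition osc_y :: "real \<Rightarrow> real" where
  "osc_y s = ln (sqrt (1 + s\<^sup>2) + s)"

definition osc_change :: "phase \<Rightarrow> phase" where
  "osc_change = (\<lambda>(q, p).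
     (vector [q $ 1, osc_y (q $ 2)], vector [p $ 1, sqrt (1 + (q $ 2)\<^sup>2) * p $ 2]))"

definition osc_potential :: "(real^2 \<Rightarrow> real) \<Rightarrow> real^2 \<Rightarrow> real" where
  "osc_potential U r = U (vector [r $ 1, inv osc_y (r $ 2)])"

definition osc_plane_hamiltonian :: "real \<Rightarrow> (real^2 \<Rightarrow> real) \<Rightarrow> phase \<Rightarrow> real" where
  "osc_plane_hamiltonian m U =
     (\<lambda>(r, p). ((p $ 1)\<^sup>2 + (p $ 2)\<^sup>2) / (2 * m) + osc_potential U r)"

text \<open>The Legendre transformation of the oscillator is invertible, so that its reduced system is
  well defined.\<close>

lemma osc_momentum:
  "momentum (osc_lagrangian m U) (\<lambda>q. q $ 2) (\<lambda>q. 0) q u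
     = vector [m * (1 + (q $ 2)\<^sup>2) * u $ 1, m * u $ 2]"
proof -
  have "dir_deriv b (L_star (osc_lagrangian m U) (\<lambda>q. q $ 2) (\<lambda>q. 0) q) u
      = m * (1 + (q $ 2)\<^sup>2) * u $ 1 * b $ 1 + m * u $ 2 * b $ 2" for b
    unfolding dir_deriv_def L_star_def osc_lagrangian_def constrained_velocity_def
    by (rule DERIV_imp_deriv)
       (auto intro!: derivative_eq_intros simp: algebra_simps power2_eq_square)
  then show ?thesis
    by (simp add: momentum_def vec_eq_iff forall_2 axis_def)
qed

lemma osc_momentum_bij:
  assumes "m > 0"
  shows "bij (momentum (osc_lagrangian m U) (\<lambda>q. q $ 2) (\<lambda>q. 0) q)"
proof (rule o_bij)
  have pos: "1 + (q $ 2)\<^sup>2 > 0"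
    by (simp add: add_pos_nonneg)
  let ?g = "\<lambda>P::real^2. vector [P $ 1 / (m * (1 + (q $ 2)\<^sup>2)), P $ 2 / m] :: real^2"
  let ?f = "momentum (osc_lagrangian m U) (\<lambda>q. q $ 2) (\<lambda>q. 0) q"
  show "?g \<circ> ?f = id" "?f \<circ> ?g = id"
    using assms pos by (auto simp: fun_eq_iff osc_momentum vec_eq_iff forall_2)
qed

end

(* The Legendre transformation gives the reduced field
     v = (P1/(m D), P2/m, -d1 U + q2 P1 P2/(m D), -d2 U)   with D = 1 + q2^2,
   in which the constraint term S cancels the q2-derivative of the kinetic energy in the last
   component.  In div (N v) only d(N P2/m)/dq2 and d(N q2 P1 P2/(m D))/dP1 survive, and they cancel
   for N = D^(-1/2).  Both changes of variables are global diffeomorphisms Phi, because y = arsinh q2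
   has the smooth inverse sinh; so the transformation of the equations of motion amounts to the
   pointwise identity DPhi v = nu (w o Phi), where sqrt D = cosh y. *)

theory Submission
  imports Defs
begin

section \<open>Closure properties of \<open>C_times\<close> and the computation of directional
  derivatives\<close>

section \<open>Calculus of smooth maps\<close>

text \<open>By uniqueness of the derivative, any explicitly computed \<open>f'\<close> may stand for
  \<open>frechet_derivative\<close>, in terms of which \<open>C_times\<close> is defined.\<close>

lemma C_times_SucI:
  assumes "\<And>x. (f has_derivative f' x) (at x)" "\<And>h. C_times n (\<lambda>x. f' x h)"
  shows "C_times (Suc n) f"
proof -
  have "frechet_derivative f (at x) = f' x" for x
    using frechet_derivative_at[OF assms(1)] by simp
  then show ?thesis
    using assms by (auto simp: differentiable_def)
qed

lemma C_times_SucD: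
  assumes "C_times (Suc n) f"
  shows "(f has_derivative frechet_derivative f (at x)) (at x)"
    and "C_times n (\<lambda>x. frechet_derivative f (at x) h)"
  using assms by (auto simp: frechet_derivative_works)

text \<open>At the bottom, differentiability gives continuity; above it, the induction hypothesis is
  applied to the directional derivatives of \<open>f\<close>.\<close>

lemma C_times_SucD': "C_times (Suc n) f \<Longrightarrow> C_times n f"
proof (induction n arbitrary: f)
  case 0
  then show ?case
    by (auto intro!: differentiable_imp_continuous_on simp: differentiable_on_def
        intro: differentiable_at_withinI)
next
  case (Suc n)
  show ?case
    by (rule C_times_SucI[OF C_times_SucD(1)[OF Suc.prems]])
       (rule Suc.IH[OF C_times_SucD(2)[OF Suc.prems]])
qed

lemma C_times_const: "C_times n (\<lambda>x. c)"
proof (induction n arbitrary: c)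
  case (Suc n)
  show ?case
    by (rule C_times_SucI[where f' = "\<lambda>x h. 0"]) (auto simp: Suc.IH)
qed simp

lemma C_times_bounded_linear:
  assumes "bounded_linear f"
  shows "C_times n f"
proof (cases n)
  case 0
  then show ?thesis
    using assms by (simp add: linear_continuous_on)
next
  case (Suc k)
  then show ?thesis
    using C_times_SucI[of f "\<lambda>x. f", OF bounded_linear_imp_has_derivative[OF assms] C_times_const]
    by simp
qed

lemma C_times_add:
  "C_times n f \<Longrightarrow> C_times n g \<Longrightarrow> C_times n (\<lambda>x. f x + g x)"
proof (induction n arbitrary: f g)
  case 0
  then show ?case by (simp add: continuous_on_add)
next
  case (Suc n)
  show ?case
    by (rule C_times_SucI[OF has_derivative_add[OF Suc.prems[THEN C_times_SucD(1)]]])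
       (rule Suc.IH[OF Suc.prems[THEN C_times_SucD(2)]])
qed

text \<open>The product rule pairs a derivative of one factor with the other factor itself, whose
  class is lowered by one. Scaling, multiplication and inner product are all instances.\<close>

lemma C_times_bounded_bilinear:
  assumes "bounded_bilinear B"
  shows "C_times n f \<Longrightarrow> C_times n g \<Longrightarrow> C_times n (\<lambda>x. B (f x) (g x))"
proof (induction n arbitrary: f g)
  case 0
  then show ?case by (auto intro: bounded_bilinear.continuous_on[OF assms])
next
  case (Suc n)
  show ?case
    by (rule C_times_SucI[OF bounded_bilinear.FDERIV[OF assms Suc.prems[THEN C_times_SucD(1)]]])
       (rule C_times_add[OF Suc.IH[OF C_times_SucD'[OF Suc.prems(1)] C_times_SucD(2)[OF Suc.prems(2)]]
          Suc.IH[OF C_times_SucD(2)[OF Suc.prems(1)] C_times_SucD'[OF Suc.prems(2)]]])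
qed

lemmas C_times_scaleR = C_times_bounded_bilinear[OF bounded_bilinear_scaleR]
lemmas C_times_mult = C_times_bounded_bilinear[OF bounded_bilinear_mult]
lemmas C_times_inner = C_times_bounded_bilinear[OF bounded_bilinear_inner]

lemma C_times_sum:
  assumes "\<And>i. i \<in> A \<Longrightarrow> C_times n (f i)"
  shows "C_times n (\<lambda>x. \<Sum>i\<in>A. f i x)"
  using assms
  by (induction A rule: infinite_finite_induct) (auto intro: C_times_const C_times_add)

text \<open>\<open>C_times\<close> controls derivatives in a fixed direction only, whereas the chain
  rule evaluates \<open>?g' (f x)\<close> in the direction \<open>?f' x h\<close>, which varies with
  \<open>x\<close>. Expanding that direction in the basis leaves fixed directions with coefficients
  of class \<open>n\<close>.\<close>

lemma C_times_compose:
  "C_times n g \<Longrightarrow> C_times n f \<Longrightarrow> C_times n (\<lambda>x. g (f x))"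
proof (induction n arbitrary: f g)
  case 0
  then show ?case by (auto intro: continuous_on_compose2)
next
  case (Suc n)
  let ?f' = "\<lambda>x. frechet_derivative f (at x)" and ?g' = "\<lambda>y. frechet_derivative g (at y)"
  have "?g' (f x) (?f' x h) = (\<Sum>b\<in>Basis. (?f' x h \<bullet> b) *\<^sub>R ?g' (f x) b)" for x h
  proof -
    have "linear (?g' (f x))"
      using C_times_SucD(1)[OF Suc.prems(1)] has_derivative_linear by blast
    then show ?thesis
      by (subst euclidean_representation[of "?f' x h", symmetric])
         (simp add: linear_sum linear_scale)
  qed
  moreover have "C_times n (\<lambda>x. \<Sum>b\<in>Basis. (?f' x h \<bullet> b) *\<^sub>R ?g' (f x) b)" for h
    by (intro C_times_sum C_times_scaleR C_times_inner C_times_const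
        C_times_SucD(2)[OF Suc.prems(2)] Suc.IH[OF C_times_SucD(2)[OF Suc.prems(1)]]
        C_times_SucD'[OF Suc.prems(2)])
  ultimately show ?case
    by (intro C_times_SucI[OF has_derivative_compose[OF
          C_times_SucD(1)[OF Suc.prems(2)] C_times_SucD(1)[OF Suc.prems(1)]]]) simp
qed

lemma C_times_real_SucI:
  fixes f :: "real \<Rightarrow> real"
  assumes "\<And>x. (f has_real_derivative f' x) (at x)" "C_times n f'"
  shows "C_times (Suc n) f"
  by (rule C_times_SucI[OF assms(1)[unfolded has_field_derivative_def]])
     (intro C_times_mult C_times_const assms(2))

lemma C_times_Pair:
  assumes "C_times n f" "C_times n g"
  shows "C_times n (\<lambda>x. (f x, g x))"
proof -
  have "C_times n (\<lambda>x. (f x, 0) + (0, g x))"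
    by (intro C_times_add C_times_compose[OF C_times_bounded_linear assms(1)]
        C_times_compose[OF C_times_bounded_linear assms(2)]
        bounded_linear_Pair bounded_linear_ident bounded_linear_zero)
  then show ?thesis by simp
qed

lemma vector_2_eq: "(vector [a, b] :: real^2) = a *\<^sub>R axis 1 1 + b *\<^sub>R axis 2 1"
  by (simp add: vec_eq_iff forall_2 axis_def)

lemma C_times_vector_2:
  "C_times n f \<Longrightarrow> C_times n g \<Longrightarrow> C_times n (\<lambda>x. vector [f x, g x] :: real^2)"
  unfolding vector_2_eq by (intro C_times_add C_times_scaleR C_times_const)

lemma has_derivative_vector_2:
  assumes "(f has_derivative f') F" "(g has_derivative g') F"
  shows "((\<lambda>x. vector [f x, g x] :: real^2) has_derivative (\<lambda>h. vector [f' h, g' h])) F"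
  unfolding vector_2_eq by (intro derivative_intros assms)

lemma diffeoI:
  assumes "smooth f" "smooth g" "\<And>x. g (f x) = x" "\<And>y. f (g y) = y"
  shows "diffeo f"
proof -
  have "bij f"
    using assms(3,4) by (intro o_bij[of g]) auto
  moreover have "inv f = g"
    using assms(3,4) by (intro inv_unique_comp) auto
  ultimately show ?thesis
    using assms(1,2) by (simp add: diffeo_def)
qed

lemma smooth_has_derivative:
  "smooth f \<Longrightarrow> (f has_derivative frechet_derivative f (at x)) (at x)"
  by (rule C_times_SucD(1)) (simp add: smooth_def)

lemma smooth_frechet_derivative:
  "smooth f \<Longrightarrow> smooth (\<lambda>x. frechet_derivative f (at x) h)"
  unfolding smooth_def by (blast intro: C_times_SucD(2))

text \<open>The chain rule along the line \<open>x + t *\<^sub>R b\<close>. It trades the total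
  function \<open>deriv\<close> for a derivative that is known to exist.\<close>

lemma dir_deriv_eq:
  assumes "(f has_derivative f') (at x)"
  shows "dir_deriv b f x = f' b"
proof -
  have "((\<lambda>t. f (x + t *\<^sub>R b)) has_derivative (\<lambda>t. f' (t *\<^sub>R b))) (at 0)"
    by (rule has_derivative_compose[of "\<lambda>t. x + t *\<^sub>R b" "\<lambda>t. t *\<^sub>R b" 0 UNIV f f'])
       (use assms in \<open>auto intro!: derivative_eq_intros\<close>)
  moreover have "(\<lambda>t. f' (t *\<^sub>R b)) = (*) (f' b)"
    using linear_scale[OF has_derivative_linear[OF assms]] by (auto simp: mult.commute)
  ultimately have "((\<lambda>t. f (x + t *\<^sub>R b)) has_real_derivative f' b) (at 0)"
    by (simp add: has_field_derivative_def)
  then show ?thesis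
    unfolding dir_deriv_def by (rule DERIV_imp_deriv)
qed

lemma C_times_vec_nth:
  "C_times n f \<Longrightarrow> C_times n (\<lambda>x. f x $ i :: real)"
  by (rule C_times_compose[OF C_times_bounded_linear[OF bounded_linear_vec_nth]])

lemma C_times_fst: "C_times n f \<Longrightarrow> C_times n (\<lambda>x. fst (f x))"
  by (rule C_times_compose[OF C_times_bounded_linear[OF bounded_linear_fst]])

lemma C_times_snd: "C_times n f \<Longrightarrow> C_times n (\<lambda>x. snd (f x))"
  by (rule C_times_compose[OF C_times_bounded_linear[OF bounded_linear_snd]])

lemma C_times_ident: "C_times n (\<lambda>x. x)"
  by (rule C_times_bounded_linear[OF bounded_linear_ident])

lemmas C_times_intros = C_times_ident C_times_const C_times_fst C_times_snd C_times_vec_nth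
  C_times_add C_times_mult C_times_scaleR C_times_Pair C_times_vector_2

section \<open>A pointwise criterion for \<open>transforms_into\<close>\<close>

section \<open>Transformation of the equations of motion\<close>

text \<open>The identity \<open>field\<close> is the chain rule for
  \<open>\<zeta> (\<tau> t) = \<Phi> (z t)\<close>. The left inverse \<open>\<Psi>\<close> serves
  the direction from \<open>w\<close> to \<open>v\<close>: it recovers \<open>z\<close> from
  \<open>\<zeta>\<close> and makes \<open>\<Phi>'\<close> injective.\<close>

lemma transforms_intoI:
  fixes \<Phi> :: "'a::euclidean_space \<Rightarrow> 'b::euclidean_space"
  assumes \<Phi>: "\<And>z. (\<Phi> has_derivative \<Phi>' z) (at z)"
    and \<Psi>: "\<And>y. (\<Psi> has_derivative \<Psi>' y) (at y)" "\<And>z. \<Psi> (\<Phi> z) = z"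
    and \<nu>: "\<And>z. \<nu> z > 0"
    and field: "\<And>z. \<Phi>' z (v z) = \<nu> z *\<^sub>R w (\<Phi> z)"
  shows "transforms_into v \<nu> \<Phi> w"
  unfolding transforms_into_def
proof (intro allI impI)
  fix I and z :: "real \<Rightarrow> 'a" and \<tau> :: "real \<Rightarrow> real" and \<zeta> :: "real \<Rightarrow> 'b"
  assume I: "open I" "is_interval I"
    and \<tau>: "\<forall>t\<in>I. (\<tau> has_real_derivative \<nu> (z t)) (at t)"
    and \<zeta>: "\<forall>t\<in>I. \<zeta> (\<tau> t) = \<Phi> (z t)"
  have lin: "linear (\<Phi>' x)" for x
    using \<Phi> has_derivative_linear by blast
  have \<Phi>'_inj: "a = b" if "\<Phi>' x a = \<Phi>' x b" for x a b
  proof -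
    have "((\<lambda>x. \<Psi> (\<Phi> x)) has_derivative (\<lambda>h. \<Psi>' (\<Phi> x) (\<Phi>' x h))) (at x)"
      by (rule has_derivative_compose[OF \<Phi> \<Psi>(1)])
    then have "((\<lambda>x. x) has_derivative (\<lambda>h. \<Psi>' (\<Phi> x) (\<Phi>' x h))) (at x)"
      by (simp add: \<Psi>(2))
    then have "(\<lambda>h. \<Psi>' (\<Phi> x) (\<Phi>' x h)) = (\<lambda>h. h)"
      using has_derivative_unique has_derivative_ident by blast
    then show ?thesis using that by metis
  qed
  \<comment> \<open>Since \<open>I\<close> is an interval, a positive derivative makes the new time
    strictly increasing, so it can be inverted.\<close>
  have \<tau>_less: "\<tau> s < \<tau> t" if "s \<in> I" "t \<in> I" "s < t" for s t
  proof (rule DERIV_pos_imp_increasing[OF that(3)])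
    fix x assume "s \<le> x" "x \<le> t"
    then have "x \<in> I" using I(2) that mem_is_interval_1_I by blast
    then show "\<exists>y. (\<tau> has_real_derivative y) (at x) \<and> 0 < y"
      using \<tau> \<nu> by blast
  qed
  then have inj: "inj_on \<tau> I"
    by (metis inj_onI less_irrefl linorder_neqE)
  have cont: "continuous_on I \<tau>"
    using \<tau> DERIV_continuous by (intro continuous_at_imp_continuous_on) blast
  \<comment> \<open>The curve \<open>\<zeta>\<close> is arbitrary outside the image of
    \<open>I\<close>; openness ensures that its derivative inside depends only on the prescribed
    values.\<close>
  have op: "open (\<tau> ` I)"
    by (rule invariance_of_domain[OF cont I(1) inj])
  define \<sigma> where "\<sigma> = inv_into I \<tau>"
  have \<sigma>: "\<sigma> (\<tau> t) = t" if "t \<in> I" for t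
    using inj that by (simp add: \<sigma>_def)
  show "solves v z I \<longleftrightarrow> solves w \<zeta> (\<tau> ` I)"
  proof
    assume z: "solves v z I"
    show "solves w \<zeta> (\<tau> ` I)"
      unfolding solves_def
    proof clarify
      fix t assume t: "t \<in> I"
      define c where "c = \<nu> (z t)"
      have c: "c > 0" by (simp add: c_def \<nu>)
      have "(\<tau> has_derivative (*) c) (at t)"
        using \<tau> t by (simp add: c_def has_field_derivative_def)
      \<comment> \<open>The inverse function theorem; the resulting factor \<open>1 / c\<close>
        cancels the factor \<open>\<nu>\<close> in \<open>field\<close>.\<close>
      then have d\<sigma>: "(\<sigma> has_derivative (\<lambda>h. h / c)) (at (\<tau> t))"
        by (intro has_derivative_inverse_strong[OF I(1) t cont]) (use c \<sigma> in auto)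
      have dz: "(z has_derivative (\<lambda>h. h *\<^sub>R v (z t))) (at (\<sigma> (\<tau> t)))"
        using z t by (simp add: solves_def has_vector_derivative_def \<sigma>)
      have "((\<lambda>s. \<Phi> (z (\<sigma> s))) has_derivative
          (\<lambda>h. \<Phi>' (z (\<sigma> (\<tau> t))) ((h / c) *\<^sub>R v (z t)))) (at (\<tau> t))"
        by (rule has_derivative_compose[OF has_derivative_compose[OF d\<sigma> dz] \<Phi>])
      moreover have "\<Phi>' (z (\<sigma> (\<tau> t))) ((h / c) *\<^sub>R v (z t)) = h *\<^sub>R w (\<zeta> (\<tau> t))" for h
        using c t \<zeta> by (simp add: \<sigma> linear_scale[OF lin] field c_def)
      ultimately have "((\<lambda>s. \<Phi> (z (\<sigma> s))) has_derivative (\<lambda>h. h *\<^sub>R w (\<zeta> (\<tau> t)))) (at (\<tau> t))"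
        by simp
      then show "(\<zeta> has_vector_derivative w (\<zeta> (\<tau> t))) (at (\<tau> t))"
        unfolding has_vector_derivative_def
        by (rule has_derivative_transform_within_open[OF _ op]) (use t \<zeta> \<sigma> in auto)
    qed
  next
    assume sol: "solves w \<zeta> (\<tau> ` I)"
    show "solves v z I"
      unfolding solves_def
    proof
      fix t assume t: "t \<in> I"
      have d\<tau>: "(\<tau> has_derivative (\<lambda>h. \<nu> (z t) * h)) (at t)"
        using \<tau> t by (simp add: has_field_derivative_def)
      have d\<zeta>: "(\<zeta> has_derivative (\<lambda>h. h *\<^sub>R w (\<Phi> (z t)))) (at (\<tau> t))"
        using sol t \<zeta> by (auto simp: solves_def has_vector_derivative_def)
      have comp: "((\<lambda>s. \<zeta> (\<tau> s)) has_derivative (\<lambda>h. (\<nu> (z t) * h) *\<^sub>R w (\<Phi> (z t)))) (at t)"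
        by (rule has_derivative_compose[OF d\<tau> d\<zeta>])
      \<comment> \<open>Differentiability of \<open>z\<close> is not given in this direction. It
        follows from writing \<open>z\<close> as \<open>\<Psi>\<close> of \<open>\<zeta>\<close> of
        \<open>\<tau>\<close>, with derivative \<open>d\<close>; comparing two derivatives of
        \<open>\<Phi>\<close> along \<open>z\<close> then identifies \<open>d\<close> with
        \<open>v (z t)\<close>.\<close>
      define d where "d = \<Psi>' (\<zeta> (\<tau> t)) (\<nu> (z t) *\<^sub>R w (\<Phi> (z t)))"
      have "((\<lambda>s. \<Psi> (\<zeta> (\<tau> s))) has_derivative
          (\<lambda>h. \<Psi>' (\<zeta> (\<tau> t)) ((\<nu> (z t) * h) *\<^sub>R w (\<Phi> (z t))))) (at t)"
        by (rule has_derivative_compose[OF comp \<Psi>(1)])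
      moreover have "\<Psi>' (\<zeta> (\<tau> t)) ((\<nu> (z t) * h) *\<^sub>R w (\<Phi> (z t))) = h *\<^sub>R d" for h
        using linear_scale[OF has_derivative_linear[OF \<Psi>(1)], of _ h "\<nu> (z t) *\<^sub>R w (\<Phi> (z t))"]
        by (simp add: d_def mult.commute)
      ultimately have "((\<lambda>s. \<Psi> (\<zeta> (\<tau> s))) has_derivative (\<lambda>h. h *\<^sub>R d)) (at t)"
        by simp
      then have dz: "(z has_derivative (\<lambda>h. h *\<^sub>R d)) (at t)"
        by (rule has_derivative_transform_within_open[OF _ I(1) t]) (simp add: \<zeta> \<Psi>(2))
      have "((\<lambda>s. \<Phi> (z s)) has_derivative (\<lambda>h. (\<nu> (z t) * h) *\<^sub>R w (\<Phi> (z t)))) (at t)"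
        by (rule has_derivative_transform_within_open[OF comp I(1) t]) (simp add: \<zeta>)
      moreover have "((\<lambda>s. \<Phi> (z s)) has_derivative (\<lambda>h. \<Phi>' (z t) (h *\<^sub>R d))) (at t)"
        by (rule has_derivative_compose[OF dz \<Phi>])
      ultimately have "(\<lambda>h. (\<nu> (z t) * h) *\<^sub>R w (\<Phi> (z t))) = (\<lambda>h. \<Phi>' (z t) (h *\<^sub>R d))"
        by (rule has_derivative_unique)
      from fun_cong[OF this, of 1] have "\<Phi>' (z t) d = \<Phi>' (z t) (v (z t))"
        by (simp add: field)
      then have "d = v (z t)" by (rule \<Phi>'_inj)
      then show "(z has_vector_derivative v (z t)) (at t)"
        using dz by (simp add: has_vector_derivative_def)
    qed
  qed
qed

section \<open>Coordinate formulas on the four-dimensional phase space\<close>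

section \<open>Canonical maps and Hamiltonian fields\<close>

lemma hamiltonian_field_eq:
  assumes "(H has_derivative H') (at z)"
  shows "hamiltonian_field H z =
    (vector [H' (0, axis 1 1), H' (0, axis 2 1)], vector [- H' (axis 1 1, 0), - H' (axis 2 1, 0)])"
  by (simp add: hamiltonian_field_def poisson_def dir_deriv_coords dir_deriv_eq[OF assms]
      vec_eq_iff forall_2 sum_2 axis_def)

lemma divergence_phase:
  fixes v :: "phase \<Rightarrow> phase"
  shows "divergence v z = dir_deriv (axis 1 1, 0) (\<lambda>z. fst (v z) $ 1) z
    + dir_deriv (axis 2 1, 0) (\<lambda>z. fst (v z) $ 2) z
    + dir_deriv (0, axis 1 1) (\<lambda>z. snd (v z) $ 1) z
    + dir_deriv (0, axis 2 1) (\<lambda>z. snd (v z) $ 2) z"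
proof -
  have "(Basis :: (real^2) set) = {axis 1 1, axis 2 1}"
    by (auto simp: Basis_vec_def UNIV_2)
  then have B: "(Basis :: phase set) = {(axis 1 1, 0), (axis 2 1, 0), (0, axis 1 1), (0, axis 2 1)}"
    by (auto simp: Basis_prod_def)
  \<comment> \<open>Needed for the four basis vectors to be distinct, so that the sum over
    \<open>Basis\<close> has exactly four terms.\<close>
  have "axis i 1 \<noteq> (0 :: real^2)" for i
    by (simp add: axis_eq_0_iff)
  then show ?thesis
    unfolding divergence_def B by (simp add: axis_eq_axis inner_prod_def inner_axis)
qed

text \<open>Applied to the derivatives of two observables, this turns the invariance of the Poisson
  bracket into an algebraic identity in their partial derivatives.\<close>

lemma linear_phase:
  fixes F :: "phase \<Rightarrow> real"
  assumes "linear F"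
  shows "F h = fst h $ 1 * F (axis 1 1, 0) + fst h $ 2 * F (axis 2 1, 0)
    + snd h $ 1 * F (0, axis 1 1) + snd h $ 2 * F (0, axis 2 1)"
proof -
  have "h = fst h $ 1 *\<^sub>R (axis 1 1, 0) + fst h $ 2 *\<^sub>R (axis 2 1, 0)
    + snd h $ 1 *\<^sub>R (0, axis 1 1) + snd h $ 2 *\<^sub>R (0, axis 2 1)"
    by (simp add: prod_eq_iff vec_eq_iff forall_2 axis_def)
  then have "F h = F (fst h $ 1 *\<^sub>R (axis 1 1, 0) + fst h $ 2 *\<^sub>R (axis 2 1, 0)
    + snd h $ 1 *\<^sub>R (0, axis 1 1) + snd h $ 2 *\<^sub>R (0, axis 2 1))"
    by (rule arg_cong)
  then show ?thesis
    by (simp add: linear_add[OF assms] linear_scale[OF assms] del: scaleR_Pair)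
qed

section \<open>The oscillator\<close>

lemma sinh_derivative: "((sinh :: real \<Rightarrow> real) has_derivative (*) (cosh s)) (at s)"
  by (rule has_field_derivative_imp_has_derivative) (auto intro!: derivative_eq_intros)

lemma one_plus_square_pos: "1 + (s::real)\<^sup>2 > 0"
  by (simp add: add_pos_nonneg)

lemma sqrt_one_plus_square_pos: "sqrt (1 + (s::real)\<^sup>2) > 0"
  by (simp add: one_plus_square_pos)

lemma DERIV_powr_one_plus_square:
  "((\<lambda>s. (1 + s\<^sup>2) powr a) has_real_derivative 2 * a * s * (1 + s\<^sup>2) powr (a - 1)) (at s)"
  by (auto intro!: derivative_eq_intros simp: one_plus_square_pos)

text \<open>The induction closes because \<open>a\<close> is arbitrary: the derivative is a linear
  factor times the power with exponent \<open>a - 1\<close>. The exponents 1/2 and -1/2 give the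
  square root and its reciprocal.\<close>

lemma C_times_powr_one_plus_square: "C_times n (\<lambda>s::real. (1 + s\<^sup>2) powr a)"
proof (induction n arbitrary: a)
  case 0
  show ?case
    using DERIV_isCont[OF DERIV_powr_one_plus_square]
    by (auto intro!: continuous_at_imp_continuous_on)
next
  case (Suc n)
  show ?case
    by (rule C_times_real_SucI[OF DERIV_powr_one_plus_square])
       (intro C_times_intros Suc.IH)
qed

lemma powr_minus_half_one_plus_square: "(1 + (s::real)\<^sup>2) powr (-1/2) = 1 / sqrt (1 + s\<^sup>2)"
  using powr_minus_divide[of "1 + s\<^sup>2" "1/2"] by (simp add: powr_half_sqrt)

lemma C_times_sqrt_one_plus_square: "C_times n (\<lambda>s::real. sqrt (1 + s\<^sup>2))"
  using C_times_powr_one_plus_square[of n "1/2"] by (simp add: powr_half_sqrt)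

lemma C_times_inverse_sqrt_one_plus_square: "C_times n (\<lambda>s::real. 1 / sqrt (1 + s\<^sup>2))"
  using C_times_powr_one_plus_square[of n "-1/2"] by (simp only: powr_minus_half_one_plus_square)

lemma C_times_arsinh: "C_times n (arsinh :: real \<Rightarrow> real)"
proof (rule C_times_SucD'[OF C_times_real_SucI])
  show "(arsinh has_real_derivative 1 / sqrt (1 + s\<^sup>2)) (at s)" for s :: real
    using arsinh_real_has_field_derivative[of s] by (simp add: add.commute)
qed (rule C_times_inverse_sqrt_one_plus_square)

text \<open>Proved jointly, since each function is the derivative of the other.\<close>

lemma C_times_sinh_cosh: "C_times n (sinh :: real \<Rightarrow> real) \<and> C_times n (cosh :: real \<Rightarrow> real)"
proof (induction n)
  case 0
  show ?case by (simp add: continuous_on_sinh continuous_on_cosh continuous_on_id)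
next
  case (Suc n)
  have "C_times (Suc n) (sinh :: real \<Rightarrow> real)"
    by (rule C_times_real_SucI[where f' = cosh]) (use Suc in \<open>auto intro!: derivative_eq_intros\<close>)
  moreover have "C_times (Suc n) (cosh :: real \<Rightarrow> real)"
    by (rule C_times_real_SucI[where f' = sinh]) (use Suc in \<open>auto intro!: derivative_eq_intros\<close>)
  ultimately show ?case ..
qed

text \<open>The logarithmic formula for the inverse hyperbolic sine. It supplies the derivative of
  \<open>osc_y\<close> and its global inverse \<open>sinh\<close>.\<close>

lemma osc_y_eq_arsinh: "osc_y = arsinh"
  by (simp add: fun_eq_iff osc_y_def arsinh_real_def add.commute)

lemma inv_osc_y: "inv osc_y = sinh"
  unfolding osc_y_eq_arsinh
  by (rule inv_unique_comp) (auto simp: fun_eq_iff arsinh_sinh_real)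

lemma osc_density_eq: "osc_density q = 1 / sqrt (1 + (q $ 2)\<^sup>2)"
  unfolding osc_density_def by (rule powr_minus_half_one_plus_square)

text \<open>The power with exponent -3/2 is rewritten as the density divided by
  \<open>1 + (q $ 2)\<^sup>2\<close>, so that the density occurs as a common factor.\<close>

lemma osc_density_has_derivative:
  "(osc_density has_derivative
    (\<lambda>h. - (q $ 2 / (1 + (q $ 2)\<^sup>2) * osc_density q) * h $ 2)) (at q)"
proof -
  have "((\<lambda>s::real. (1 + s\<^sup>2) powr (-1/2)) has_derivative
      (\<lambda>h. (2 * (-1/2) * q $ 2 * (1 + (q $ 2)\<^sup>2) powr (-1/2 - 1)) * h)) (at (q $ 2))"
    using DERIV_powr_one_plus_square[of "-1/2" "q $ 2"] unfolding has_field_derivative_def .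
  from has_derivative_compose[OF bounded_linear_imp_has_derivative[OF bounded_linear_vec_nth] this]
  have *: "(osc_density has_derivative
      (\<lambda>h. (2 * (-1/2) * q $ 2 * (1 + (q $ 2)\<^sup>2) powr (-1/2 - 1)) * h $ 2)) (at q)"
    by (simp add: osc_density_def[abs_def])
  have "(1 + (q $ 2)\<^sup>2) powr (-1/2 - 1) = osc_density q / (1 + (q $ 2)\<^sup>2)"
    unfolding osc_density_def
    by (simp only: powr_diff powr_one one_plus_square_pos less_imp_le)
  with * show ?thesis by (simp add: field_simps)
qed

lemma C_times_osc_density: "C_times n osc_density"
  unfolding osc_density_eq[abs_def]
  by (rule C_times_compose[OF C_times_inverse_sqrt_one_plus_square]) (intro C_times_intros)

section \<open>The Legendre transformation and explicit forms of the vector fields\<close>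

lemma osc_velocity:
  assumes "m > 0"
  shows "velocity (osc_lagrangian m U) (\<lambda>q. q $ 2) (\<lambda>q. 0) q P
    = vector [P $ 1 / (m * (1 + (q $ 2)\<^sup>2)), P $ 2 / m]"
  unfolding velocity_def
  by (rule inv_f_eq[OF bij_is_inj[OF osc_momentum_bij[OF assms]]])
     (use assms one_plus_square_pos[of "q $ 2"] in
       \<open>auto simp: osc_momentum vec_eq_iff forall_2\<close>)

lemma osc_reduced_hamiltonian:
  assumes "m > 0"
  shows "reduced_hamiltonian (osc_lagrangian m U) (\<lambda>q. q $ 2) (\<lambda>q. 0) =
    (\<lambda>z. (snd z $ 1)\<^sup>2 / (2 * m * (1 + (fst z $ 2)\<^sup>2)) + (snd z $ 2)\<^sup>2 / (2 * m) + U (fst z))"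
proof (rule ext, clarify)
  fix q P :: "real^2"
  define D where "D = 1 + (q $ 2)\<^sup>2"
  have D: "D > 0" by (simp add: D_def one_plus_square_pos)
  \<comment> \<open>The last square in the kinetic energy is that of the third velocity, which the
    constraint sets to \<open>q $ 2\<close> times the first; together with the first square it
    yields the factor \<open>D\<close>.\<close>
  have "P $ 1 * (P $ 1 / (m * D)) + P $ 2 * (P $ 2 / m)
      - 1/2 * m * ((P $ 1 / (m * D))\<^sup>2 + (P $ 2 / m)\<^sup>2 + (q $ 2)\<^sup>2 * (P $ 1 / (m * D))\<^sup>2)
    = P $ 1 * (P $ 1 / (m * D)) + P $ 2 * (P $ 2 / m)
      - 1/2 * m * (D * (P $ 1 / (m * D))\<^sup>2 + (P $ 2 / m)\<^sup>2)"
    by (simp add: D_def algebra_simps)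
  also have "\<dots> = (P $ 1)\<^sup>2 / (2 * m * D) + (P $ 2)\<^sup>2 / (2 * m)"
    using assms D by (simp add: field_simps power2_eq_square)
  finally show "reduced_hamiltonian (osc_lagrangian m U) (\<lambda>q. q $ 2) (\<lambda>q. 0) (q, P) =
    (snd (q, P) $ 1)\<^sup>2 / (2 * m * (1 + (fst (q, P) $ 2)\<^sup>2)) + (snd (q, P) $ 2)\<^sup>2 / (2 * m)
    + U (fst (q, P))"
    by (simp add: reduced_hamiltonian_def osc_velocity[OF assms] Let_def L_star_def
        osc_lagrangian_def constrained_velocity_def power_mult_distrib flip: D_def)
qed

context
  fixes m :: real and U :: "real^2 \<Rightarrow> real" and U' :: "real^2 \<Rightarrow> real^2 \<Rightarrow> real"
  assumes m: "m > 0" and U': "\<And>q. (U has_derivative U' q) (at q)"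
begin

lemma U'_axis: "U' q a = a $ 1 * U' q (axis 1 1) + a $ 2 * U' q (axis 2 1)"
proof -
  have lin: "linear (U' q)"
    using U' has_derivative_linear by blast
  have "a = a $ 1 *\<^sub>R axis 1 1 + a $ 2 *\<^sub>R axis 2 1"
    by (simp add: vec_eq_iff forall_2 axis_def)
  then have "U' q a = U' q (a $ 1 *\<^sub>R axis 1 1 + a $ 2 *\<^sub>R axis 2 1)"
    by (rule arg_cong)
  then show ?thesis
    by (simp add: linear_add[OF lin] linear_scale[OF lin])
qed

lemma U'_zero: "U' q 0 = 0"
  using linear_0[OF has_derivative_linear[OF U']] .

lemma U_fst_has_derivative:
  "((\<lambda>z::phase. U (fst z)) has_derivative (\<lambda>h. U' (fst z) (fst h))) (at z)"
  by (rule has_derivative_compose[OF _ U']) (auto intro!: derivative_eq_intros)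

lemma osc_field_eq:
  "osc_field m U = (\<lambda>(q, P).
    (vector [P $ 1 / (m * (1 + (q $ 2)\<^sup>2)), P $ 2 / m],
     vector [q $ 2 * P $ 1 * P $ 2 / (m * (1 + (q $ 2)\<^sup>2)) - U' q (axis 1 1),
             - U' q (axis 2 1)]))"
proof (rule ext, clarify)
  fix q P :: "real^2"
  define D where "D = 1 + (q $ 2)\<^sup>2"
  have D: "D > 0" by (simp add: D_def one_plus_square_pos)
  let ?a2 = "\<lambda>q::real^2. q $ 2"
  let ?H = "reduced_hamiltonian (osc_lagrangian m U) ?a2 (\<lambda>q. 0)"
  have vec: "((\<lambda>x::real^2. x $ i) has_derivative (\<lambda>h. h $ i)) F" for i F
    by (rule bounded_linear_imp_has_derivative[OF bounded_linear_vec_nth])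
  have "(?H has_derivative (\<lambda>h. P $ 1 * snd h $ 1 / (m * D)
      - (P $ 1)\<^sup>2 * q $ 2 * fst h $ 2 / (m * D\<^sup>2) + P $ 2 * snd h $ 2 / m + U' q (fst h)))
      (at (q, P))"
    unfolding osc_reduced_hamiltonian[OF m]
    using m D
    by (auto intro!: derivative_eq_intros U_fst_has_derivative
        bounded_linear.has_derivative[OF bounded_linear_vec_nth]
        simp: fun_eq_iff simp flip: D_def)
      (auto simp: field_simps power2_eq_square)
  note dH = dir_deriv_eq[OF this]
  have a1: "partial 2 (\<lambda>q. q $ 2) q = 1"
    by (subst dir_deriv_eq[OF vec]) (simp add: axis_def)
  have a2: "partial 1 (\<lambda>q::real^2. 0) q = 0"
    by (subst dir_deriv_eq[OF has_derivative_const]) simp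
  have "partial 3 (osc_lagrangian m U q) u = m * u $ 3" for u
    unfolding dir_deriv_def osc_lagrangian_def
    by (rule DERIV_imp_deriv) (auto intro!: derivative_eq_intros simp: axis_def)
  \<comment> \<open>At the constrained velocity the third momentum is \<open>m * q $ 2\<close> times
    \<open>P $ 1 / (m * D)\<close>, and the bracket of derivatives of the constraint coefficients
    equals 1.\<close>
  then have S: "S_term (osc_lagrangian m U) ?a2 (\<lambda>q. 0) q
      (velocity (osc_lagrangian m U) ?a2 (\<lambda>q. 0) q P) = q $ 2 * P $ 1 / D"
    using m D by (simp add: S_term_def a1 a2 constrained_velocity_def osc_velocity[OF m] flip: D_def)
  show "osc_field m U (q, P) =
    (vector [P $ 1 / (m * (1 + (q $ 2)\<^sup>2)), P $ 2 / m],
     vector [q $ 2 * P $ 1 * P $ 2 / (m * (1 + (q $ 2)\<^sup>2)) - U' q (axis 1 1),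
             - U' q (axis 2 1)])"
    unfolding osc_field_def reduced_field_def
    using m D
    by (simp add: Let_def S dH axis_def U'_zero flip: D_def)
       (simp add: field_simps power2_eq_square)
qed

lemma osc_hamiltonian_field_eq:
  "hamiltonian_field (osc_hamiltonian m U) = (\<lambda>(q, p).
    (vector [p $ 1 / m, (1 + (q $ 2)\<^sup>2) * p $ 2 / m],
     vector [- U' q (axis 1 1), - q $ 2 * (p $ 2)\<^sup>2 / m - U' q (axis 2 1)]))"
proof (rule ext, clarify)
  fix q p :: "real^2"
  have "(osc_hamiltonian m U has_derivative (\<lambda>h. p $ 1 * snd h $ 1 / m
      + q $ 2 * fst h $ 2 * (p $ 2)\<^sup>2 / m + (1 + (q $ 2)\<^sup>2) * p $ 2 * snd h $ 2 / m
      + U' q (fst h))) (at (q, p))"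
    unfolding osc_hamiltonian_def case_prod_beta
    using m
    by (auto intro!: derivative_eq_intros U_fst_has_derivative
        bounded_linear.has_derivative[OF bounded_linear_vec_nth]
        simp: fun_eq_iff)
      (auto simp: field_simps power2_eq_square)
  from hamiltonian_field_eq[OF this]
  show "hamiltonian_field (osc_hamiltonian m U) (q, p) =
    (vector [p $ 1 / m, (1 + (q $ 2)\<^sup>2) * p $ 2 / m],
     vector [- U' q (axis 1 1), - q $ 2 * (p $ 2)\<^sup>2 / m - U' q (axis 2 1)])"
    by (simp add: axis_def U'_zero)
qed

text \<open>The chain rule through \<open>q $ 2 = sinh (r $ 2)\<close> brings in
  \<open>cosh\<close>. Evaluating \<open>U'\<close> at the original point \<open>q\<close> makes the
  field comparable with the one in the variables \<open>(q, p)\<close>.\<close>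

lemma osc_mass_point_field_eq:
  "mass_point_field m (osc_potential U) = (\<lambda>(r, p). let q = vector [r $ 1, sinh (r $ 2)] in
    (vector [p $ 1 / m, p $ 2 / m],
     vector [- U' q (axis 1 1), - cosh (r $ 2) * U' q (axis 2 1)]))"
proof (rule ext, clarify)
  fix r p :: "real^2"
  define q :: "real^2" where "q = vector [r $ 1, sinh (r $ 2)]"
  have "((\<lambda>r::real^2. vector [r $ 1, sinh (r $ 2)] :: real^2) has_derivative
      (\<lambda>h. vector [h $ 1, cosh (r $ 2) * h $ 2])) (at r)"
    by (intro has_derivative_vector_2 bounded_linear_imp_has_derivative[OF bounded_linear_vec_nth]
        has_derivative_compose[OF bounded_linear_imp_has_derivative[OF bounded_linear_vec_nth]
          sinh_derivative])
  from dir_deriv_eq[OF has_derivative_compose[OF this U']]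
  have "dir_deriv b (osc_potential U) r = U' q (vector [b $ 1, cosh (r $ 2) * b $ 2])" for b
    unfolding osc_potential_def[abs_def] inv_osc_y q_def .
  then have "dir_deriv b (osc_potential U) r
      = b $ 1 * U' q (axis 1 1) + cosh (r $ 2) * b $ 2 * U' q (axis 2 1)" for b
    by (subst (asm) U'_axis) simp
  then show "mass_point_field m (osc_potential U) (r, p) =
    (let q = vector [r $ 1, sinh (r $ 2)] in
    (vector [p $ 1 / m, p $ 2 / m],
     vector [- U' q (axis 1 1), - cosh (r $ 2) * U' q (axis 2 1)]))"
    by (simp add: mass_point_field_def q_def[symmetric] vec_eq_iff forall_2 axis_def)
qed

section \<open>The invariant measure\<close>

lemma osc_invariant_measure:
  assumes "smooth U"
  shows "invariant_measure (\<lambda>(q, P). osc_density q) (osc_field m U)"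
proof -
  let ?w = "\<lambda>z. (case z of (q, P) \<Rightarrow> osc_density q) *\<^sub>R osc_field m U z"
  define N :: "real \<Rightarrow> real" where "N s = (1 + s\<^sup>2) powr (-1/2)" for s
  have N: "osc_density q = N (q $ 2)" for q
    by (simp add: N_def osc_density_def)
  have U'_eq: "U' q = frechet_derivative U (at q)" for q
    using frechet_derivative_at[OF U'] .
  have C_U': "C_times n (\<lambda>z::phase. U' (fst z) b)" for n b
    unfolding U'_eq
    by (rule C_times_compose[where f = fst and g = "\<lambda>q. frechet_derivative U (at q) b"])
      (use smooth_frechet_derivative[OF assms] in
        \<open>auto simp: smooth_def intro: C_times_bounded_linear bounded_linear_fst\<close>)
  have C_N: "C_times n (\<lambda>z::phase. N (fst z $ 2))" for n
    unfolding N[symmetric] by (rule C_times_compose[OF C_times_osc_density]) (intro C_times_intros)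
  \<comment> \<open>With \<open>N * N\<close> in place of the reciprocal of
    \<open>1 + (q $ 2)\<^sup>2\<close>, and with constant factors in place of quotients and
    differences, the field is built from sums and products only, as \<open>C_times_intros\<close>
    requires.\<close>
  have w: "?w = (\<lambda>z. let q = fst z; P = snd z; N = N (q $ 2) in
    (vector [N * (P $ 1 * (1 / m) * (N * N)), N * (P $ 2 * (1 / m))],
     vector [N * (q $ 2 * P $ 1 * P $ 2 * (1 / m) * (N * N) + (-1) * U' q (axis 1 1)),
             N * ((-1) * U' q (axis 2 1))]))"
  proof
    fix z :: phase
    obtain q P where z: "z = (q, P)" by (cases z)
    have "N (q $ 2) * N (q $ 2) = 1 / (1 + (q $ 2)\<^sup>2)"
      unfolding N[symmetric] osc_density_eq using one_plus_square_pos[of "q $ 2"] by simp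
    then show "?w z = (let q = fst z; P = snd z; N = N (q $ 2) in
    (vector [N * (P $ 1 * (1 / m) * (N * N)), N * (P $ 2 * (1 / m))],
     vector [N * (q $ 2 * P $ 1 * P $ 2 * (1 / m) * (N * N) + (-1) * U' q (axis 1 1)),
             N * ((-1) * U' q (axis 2 1))]))"
      by (simp add: z osc_field_eq Let_def vec_eq_iff forall_2 N)
  qed
  \<comment> \<open>The field contains first derivatives of \<open>U\<close>, so its
    differentiability uses second derivatives of \<open>U\<close>.\<close>
  have "C_times (Suc 0) ?w"
    unfolding w Let_def by (intro C_times_intros C_U' C_N)
  then have "?w differentiable (at z)" for z
    using C_times_SucD(1) differentiableI by blast
  moreover have "divergence ?w z = 0" for z
  proof -
    obtain q P where z: "z = (q, P)" by (cases z)
    \<comment> \<open>The power with exponent -3/2 is the cube of \<open>N\<close>, which keeps the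
      divergence polynomial in \<open>N\<close>.\<close>
    have dN: "(N has_real_derivative - s * (N s * N s * N s)) (at s)" for s
    proof -
      have "N s * N s * N s = (1 + s\<^sup>2) powr (-1/2 - 1)"
        unfolding N_def powr_add[symmetric] by simp
      then show ?thesis
        using DERIV_powr_one_plus_square[of "-1/2" s] by (simp add: N_def[abs_def])
    qed
    have dN': "((\<lambda>t. N (s + t)) has_real_derivative - s * (N s * N s * N s)) (at 0)" for s
      using DERIV_shift[of N "- s * (N s * N s * N s)" 0 s] dN[of s] by (simp add: add.commute)
    have "divergence ?w z = dir_deriv (axis 1 1, 0) (\<lambda>z. fst (?w z) $ 1) z
        + dir_deriv (axis 2 1, 0) (\<lambda>z. fst (?w z) $ 2) z
        + dir_deriv (0, axis 1 1) (\<lambda>z. snd (?w z) $ 1) z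
        + dir_deriv (0, axis 2 1) (\<lambda>z. snd (?w z) $ 2) z"
      by (rule divergence_phase)
    \<comment> \<open>The first position component does not depend on the first position, nor the
      second momentum component on the second momentum. The other two terms turn out to be
      opposite.\<close>
    also have "dir_deriv (axis 1 1, 0) (\<lambda>z. fst (?w z) $ 1) z = 0"
      unfolding fun_cong[OF w] dir_deriv_def z by (simp add: Let_def axis_def)
    also have "dir_deriv (0, axis 2 1) (\<lambda>z. snd (?w z) $ 2) z = 0"
      unfolding fun_cong[OF w] dir_deriv_def z by (simp add: Let_def)
    also have "dir_deriv (axis 2 1, 0) (\<lambda>z. fst (?w z) $ 2) z
        = - (q $ 2 * (N (q $ 2) * N (q $ 2) * N (q $ 2)) * P $ 2 / m)"
      unfolding fun_cong[OF w] dir_deriv_def z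
      by (rule DERIV_imp_deriv)
         (use m in \<open>auto simp: Let_def axis_def intro!: derivative_eq_intros dN'\<close>)
    also have "dir_deriv (0, axis 1 1) (\<lambda>z. snd (?w z) $ 1) z
        = q $ 2 * (N (q $ 2) * N (q $ 2) * N (q $ 2)) * P $ 2 / m"
      unfolding fun_cong[OF w] dir_deriv_def z
      by (rule DERIV_imp_deriv)
         (use m in \<open>auto simp: Let_def axis_def intro!: derivative_eq_intros\<close>)
    finally show ?thesis by simp
  qed
  ultimately show ?thesis
    unfolding invariant_measure_def by blast
qed

end

section \<open>Rescaled momenta and rescaled time\<close>

lemma osc_rescaled_momenta_eq: "osc_rescaled_momenta = (\<lambda>z. (fst z, osc_density (fst z) *\<^sub>R snd z))"
  by (simp add: osc_rescaled_momenta_def fun_eq_iff)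

text \<open>The inverse of \<open>osc_rescaled_momenta\<close>, with the reciprocal of the density
  written as a square root whose smoothness is known.\<close>

definition osc_original_momenta :: "phase \<Rightarrow> phase" where
  "osc_original_momenta = (\<lambda>z. (fst z, sqrt (1 + (fst z $ 2)\<^sup>2) *\<^sub>R snd z))"

lemma osc_momenta_inverse:
  "osc_original_momenta (osc_rescaled_momenta z) = z"
  "osc_rescaled_momenta (osc_original_momenta z) = z"
  using sqrt_one_plus_square_pos[of "fst z $ 2"]
  by (simp_all add: osc_original_momenta_def osc_rescaled_momenta_eq osc_density_eq)

lemma smooth_osc_rescaled_momenta: "smooth osc_rescaled_momenta"
  unfolding smooth_def osc_rescaled_momenta_eq
  by (intro allI C_times_Pair C_times_scaleR C_times_compose[OF C_times_osc_density] C_times_intros)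

lemma smooth_osc_original_momenta: "smooth osc_original_momenta"
  unfolding smooth_def osc_original_momenta_def
  by (intro allI C_times_Pair C_times_scaleR C_times_compose[OF C_times_sqrt_one_plus_square]
      C_times_intros)

lemma osc_rescaled_momenta_has_derivative:
  "(osc_rescaled_momenta has_derivative (\<lambda>h. (fst h, osc_density (fst z) *\<^sub>R snd h
    + (- (fst z $ 2 / (1 + (fst z $ 2)\<^sup>2) * osc_density (fst z)) * fst h $ 2) *\<^sub>R snd z))) (at z)"
proof -
  have "((\<lambda>z::phase. osc_density (fst z)) has_derivative
    (\<lambda>h. - (fst z $ 2 / (1 + (fst z $ 2)\<^sup>2) * osc_density (fst z)) * fst h $ 2)) (at z)"
    by (rule has_derivative_compose[OF _ osc_density_has_derivative])
       (auto intro!: derivative_eq_intros)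
  then show ?thesis
    unfolding osc_rescaled_momenta_eq by (auto intro!: derivative_eq_intros)
qed

text \<open>Differentiating the density along the flow cancels the velocity-dependent force on the
  first momentum, and produces the force \<open>- q $ 2 * (p $ 2)\<^sup>2 / m\<close> on the second
  one.\<close>

lemma osc_transforms_rescaled:
  assumes "m > 0" "smooth U"
  shows "transforms_into (osc_field m U) (\<lambda>(q, P). osc_density q) osc_rescaled_momenta
    (hamiltonian_field (osc_hamiltonian m U))"
proof (rule transforms_intoI[OF osc_rescaled_momenta_has_derivative
      smooth_has_derivative[OF smooth_osc_original_momenta] osc_momenta_inverse(1)])
  fix z :: phase
  obtain q P where z: "z = (q, P)" by (cases z)
  define s N where "s = q $ 2" and "N = osc_density q"
  have D: "1 + s\<^sup>2 > 0" by (rule one_plus_square_pos)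
  \<comment> \<open>Eliminating \<open>1 + s\<^sup>2\<close> in favour of \<open>N\<close> makes the
    field identity rational.\<close>
  have N: "N > 0" "1 + s\<^sup>2 = 1 / N\<^sup>2"
    using D by (simp_all add: N_def s_def osc_density_eq power_divide)
  show "(case z of (q, P) \<Rightarrow> osc_density q) > 0"
    using N by (simp add: z N_def)
  note U = smooth_has_derivative[OF assms(2)]
  note flds = osc_field_eq[of m U, OF assms(1) U] osc_hamiltonian_field_eq[of m U, OF assms(1) U]
  show "(fst (osc_field m U z), osc_density (fst z) *\<^sub>R snd (osc_field m U z)
      + (- (fst z $ 2 / (1 + (fst z $ 2)\<^sup>2) * osc_density (fst z)) * fst (osc_field m U z) $ 2) *\<^sub>R snd z)
    = (case z of (q, P) \<Rightarrow> osc_density q) *\<^sub>R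
      hamiltonian_field (osc_hamiltonian m U) (osc_rescaled_momenta z)"
    unfolding flds osc_rescaled_momenta_eq z
    using assms(1) N(1)
    by (auto simp: vec_eq_iff forall_2 N(2) simp flip: s_def N_def)
       (auto simp: field_simps power2_eq_square)
qed

section \<open>The canonical change to the motion of a mass point on the plane\<close>

lemma osc_change_eq:
  "osc_change = (\<lambda>z. (vector [fst z $ 1, arsinh (fst z $ 2)],
     vector [snd z $ 1, sqrt (1 + (fst z $ 2)\<^sup>2) * snd z $ 2]))"
  by (simp add: osc_change_def fun_eq_iff osc_y_eq_arsinh)

text \<open>The momentum factor is the reciprocal of \<open>cosh\<close>, kept as a square root so
  that it cancels the factor in \<open>osc_change\<close> literally.\<close>

definition osc_change_back :: "phase \<Rightarrow> phase" where
  "osc_change_back = (\<lambda>z. (vector [fst z $ 1, sinh (fst z $ 2)],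
     vector [snd z $ 1, 1 / sqrt (1 + (sinh (fst z $ 2))\<^sup>2) * snd z $ 2]))"

lemma osc_change_inverse:
  "osc_change_back (osc_change z) = z"
  "osc_change (osc_change_back z) = z"
  using sqrt_one_plus_square_pos[of "fst z $ 2"] sqrt_one_plus_square_pos[of "sinh (fst z $ 2)"]
  by (auto simp add: osc_change_back_def osc_change_eq prod_eq_iff vec_eq_iff forall_2
      arsinh_sinh_real)

lemma smooth_osc_change: "smooth osc_change"
  unfolding smooth_def osc_change_eq
  by (intro allI C_times_Pair C_times_vector_2 C_times_mult C_times_compose[OF C_times_arsinh]
      C_times_compose[OF C_times_sqrt_one_plus_square] C_times_intros)

lemma smooth_osc_change_back: "smooth osc_change_back"
  unfolding smooth_def osc_change_back_def
  by (intro allI C_times_Pair C_times_vector_2 C_times_mult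
      C_times_compose[OF C_times_inverse_sqrt_one_plus_square]
      C_times_compose[OF conjunct1[OF C_times_sinh_cosh]] C_times_intros)

lemma osc_change_has_derivative:
  "(osc_change has_derivative (\<lambda>h.
    (vector [fst h $ 1, fst h $ 2 / sqrt (1 + (fst z $ 2)\<^sup>2)],
     vector [snd h $ 1, fst z $ 2 / sqrt (1 + (fst z $ 2)\<^sup>2) * fst h $ 2 * snd z $ 2
       + sqrt (1 + (fst z $ 2)\<^sup>2) * snd h $ 2]))) (at z)"
proof -
  note vec_nth = bounded_linear.has_derivative[OF bounded_linear_vec_nth]
  have q2: "((\<lambda>z::phase. fst z $ 2) has_derivative (\<lambda>h. fst h $ 2)) (at z)"
    by (auto intro!: derivative_eq_intros vec_nth)
  have "((\<lambda>z::phase. arsinh (fst z $ 2)) has_derivative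
      (\<lambda>h. 1 / sqrt ((fst z $ 2)\<^sup>2 + 1) * fst h $ 2)) (at z)"
    by (rule has_derivative_compose[OF q2
          arsinh_real_has_field_derivative[unfolded has_field_derivative_def]])
  then have "((\<lambda>z::phase. arsinh (fst z $ 2)) has_derivative
      (\<lambda>h. fst h $ 2 / sqrt (1 + (fst z $ 2)\<^sup>2))) (at z)"
    by (simp add: add.commute)
  moreover have "((\<lambda>z::phase. sqrt (1 + (fst z $ 2)\<^sup>2) * snd z $ 2) has_derivative
     (\<lambda>h. fst z $ 2 / sqrt (1 + (fst z $ 2)\<^sup>2) * fst h $ 2 * snd z $ 2
       + sqrt (1 + (fst z $ 2)\<^sup>2) * snd h $ 2)) (at z)"
    using one_plus_square_pos[of "fst z $ 2"]
    by (auto intro!: derivative_eq_intros vec_nth simp: fun_eq_iff) (auto simp: field_simps)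
  ultimately show ?thesis
    unfolding osc_change_eq
    by (intro has_derivative_Pair has_derivative_vector_2)
       (auto intro!: derivative_eq_intros vec_nth)
qed

text \<open>A point transformation: the second momentum is divided by the derivative
  \<open>1 / r\<close> of the new coordinate. In the bracket \<open>r\<close> cancels
  \<open>1 / r\<close>, and the contributions of the mixed entry with \<open>s / r\<close> cancel by
  antisymmetry.\<close>

lemma canonical_osc_change: "canonical osc_change"
proof -
  have "poisson (F \<circ> osc_change) (G \<circ> osc_change) z = poisson F G (osc_change z)"
    if F: "smooth F" and G: "smooth G" for F G z
  proof -
    note chain = has_derivative_compose[OF osc_change_has_derivative smooth_has_derivative]
    define s r where "s = fst z $ 2" and "r = sqrt (1 + s\<^sup>2)"
    have r: "r > 0" unfolding r_def by (rule sqrt_one_plus_square_pos)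
    let ?F' = "frechet_derivative F (at (osc_change z))"
    let ?G' = "frechet_derivative G (at (osc_change z))"
    have lin: "linear ?F'" "linear ?G'"
      using F G smooth_has_derivative has_derivative_linear by blast+
    have FG: "dir_deriv b F (osc_change z) = ?F' b" "dir_deriv b G (osc_change z) = ?G' b" for b
      using F G by (auto intro: dir_deriv_eq smooth_has_derivative)
    define v where "v h = ((vector [fst h $ 1, fst h $ 2 / r],
      vector [snd h $ 1, s / r * fst h $ 2 * snd z $ 2 + r * snd h $ 2]) :: phase)" for h :: phase
    have comp: "dir_deriv b (F \<circ> osc_change) z = ?F' (v b)"
      "dir_deriv b (G \<circ> osc_change) z = ?G' (v b)" for b
      unfolding comp_def v_def r_def s_def
      by (rule dir_deriv_eq[OF chain[OF F]], rule dir_deriv_eq[OF chain[OF G]])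
    show ?thesis
      unfolding poisson_def sum_2 comp FG
        linear_phase[OF lin(1), of "v _"] linear_phase[OF lin(2), of "v _"]
      using r by (simp add: v_def axis_def field_simps)
  qed
  moreover have "diffeo osc_change"
    by (rule diffeoI[OF smooth_osc_change smooth_osc_change_back osc_change_inverse])
  ultimately show ?thesis
    by (simp add: canonical_def)
qed

lemma osc_hamiltonian_change:
  "osc_hamiltonian m U = osc_plane_hamiltonian m U \<circ> osc_change"
proof (rule ext, clarify)
  fix q p :: "real^2"
  have "vector [q $ 1, q $ 2] = q"
    by (simp add: vec_eq_iff forall_2)
  then show "osc_hamiltonian m U (q, p) = (osc_plane_hamiltonian m U \<circ> osc_change) (q, p)"
    using one_plus_square_pos[of "q $ 2"]
    by (simp add: osc_hamiltonian_def osc_plane_hamiltonian_def osc_change_eq osc_potential_def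
        inv_osc_y power_mult_distrib add_divide_distrib)
qed

text \<open>Checked directly on the vector fields, with time unchanged. In the second momentum the
  derivative of the square root cancels the force quadratic in \<open>p $ 2\<close>; what remains is
  the potential force times \<open>r\<close>, which is \<open>cosh\<close> of the new
  coordinate.\<close>

lemma osc_transforms_change:
  assumes "m > 0" "smooth U"
  shows "transforms_into (hamiltonian_field (osc_hamiltonian m U)) (\<lambda>_. 1) osc_change
    (mass_point_field m (osc_potential U))"
proof (rule transforms_intoI[OF osc_change_has_derivative
      smooth_has_derivative[OF smooth_osc_change_back] osc_change_inverse(1)])
  fix z :: phase
  obtain q p where z: "z = (q, p)" by (cases z)
  define s r where "s = q $ 2" and "r = sqrt (1 + s\<^sup>2)"
  have r: "r > 0" "1 + s\<^sup>2 = r\<^sup>2"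
    using one_plus_square_pos[of s] by (simp_all add: r_def)
  have q: "vector [q $ 1, s] = q"
    by (simp add: vec_eq_iff forall_2 s_def)
  note U = smooth_has_derivative[OF assms(2)]
  note flds = osc_hamiltonian_field_eq[of m U, OF assms(1) U]
    osc_mass_point_field_eq[of m U, OF assms(1) U]
  let ?v = "hamiltonian_field (osc_hamiltonian m U) z"
  show "(vector [fst ?v $ 1, fst ?v $ 2 / sqrt (1 + (fst z $ 2)\<^sup>2)],
     vector [snd ?v $ 1, fst z $ 2 / sqrt (1 + (fst z $ 2)\<^sup>2) * fst ?v $ 2 * snd z $ 2
       + sqrt (1 + (fst z $ 2)\<^sup>2) * snd ?v $ 2])
    = 1 *\<^sub>R mass_point_field m (osc_potential U) (osc_change z)"
    unfolding flds osc_change_eq z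
    using assms(1) r(1)
    by (auto simp: Let_def vec_eq_iff forall_2 cosh_arsinh_real add.commute[of _ 1] q r(2)
        simp flip: s_def r_def)
       (auto simp: field_simps power2_eq_square)
qed simp

theorem mainTheorem3:
  fixes m :: real and U :: "real^2 \<Rightarrow> real"
  assumes "m > 0" and "smooth U"
  shows
    "invariant_measure (\<lambda>(q, P). osc_density q) (osc_field m U)
     \<and> (diffeo osc_rescaled_momenta
        \<and> transforms_into (osc_field m U) (\<lambda>(q, P). osc_density q) osc_rescaled_momenta
            (hamiltonian_field (osc_hamiltonian m U)))
     \<and> (canonical osc_change
        \<and> osc_hamiltonian m U = osc_plane_hamiltonian m U \<circ> osc_change
        \<and> transforms_into (hamiltonian_field (osc_hamiltonian m U)) (\<lambda>_. 1) osc_change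
            (mass_point_field m (osc_potential U)))"
  by (intro conjI osc_invariant_measure[OF assms(1) smooth_has_derivative[OF assms(2)] assms(2)]
      diffeoI[OF smooth_osc_rescaled_momenta smooth_osc_original_momenta osc_momenta_inverse]
      osc_transforms_rescaled[OF assms] canonical_osc_change osc_hamiltonian_change
      osc_transforms_change[OF assms])

end
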